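(* Let $T\ge 2$ be an integer and $p\in(0,1)$. Let $\{U_n\}_{n\ge 0}$ be a sequence of independent random variables with $U_{kT}=1$ almost surely for all $k\ge 0$ and $U_n$ Bernoulli with parameter $p$ for every $n\ge 0$ that is not a multiple of $T$. Let $\{X_n\}_{n\ge 0}$ be a strictly stationary sequence of positive random variables with continuous marginal distribution function $F$, independent of $\{U_n\}_{n\ge 0}$. Define $$Y_n=U_nX_n+(1-U_n)\max_{[(n-1)/T]\,T\le i\le n-1}U_iX_i,\qquad n\ge 1 .$$ Let $\{u_n\}_{n\ge1}$ be any sequence of positive real numbers such that $\{Y_n\}$ satisfies condition $D(u_n)$, with sequence $\ell_n=o(n)$ and mixing coefficients $\alpha_{n,\ell_n}\to 0$, and let $\{k_n\}_{n\ge1}$ be a sequence of positive integers with $k_n\to+\infty$, $k_n\ell_n/n\to0$ and $k_n\alpha_{n,\ell_n}\to0$. If $$nP\Big(\max_{0\le j\le T}X_j>u_n\ge X_{T+1},\ M^{(\mathbf X)}_{T+2,\,[\frac{n}{k_nT}]T+T}>u_n\Big)\longrightarrow0\quad (n\to+\infty),$$ then condition $D_T^{(T+1)}(u_n)$ holds for $\{Y_n\}_{n\ge1}$.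
   Context: $[a]$ denotes the integer part of the real number $a$. For a sequence $\mathbf W=\{W_n\}$ of random variables, $M^{(\mathbf W)}_{i,j}=\max_{i\le m\le j}W_m$ for $i\le j$ and $M^{(\mathbf W)}_{i,j}=-\infty$ for $i>j$. Condition $D(u_n)$ for $\mathbf W$: there is a sequence $\ell_n=o(n)$ such that $\alpha_{n,\ell_n}\to0$, where $\alpha_{n,\ell_n}$ is the supremum of $|P(M^{(\mathbf W)}_{i_1,i_1+a}\le u_n, M^{(\mathbf W)}_{j_1,j_1+b}\le u_n)-P(M^{(\mathbf W)}_{i_1,i_1+a}\le u_n)P(M^{(\mathbf W)}_{j_1,j_1+b}\le u_n)|$ over all integers with $1\le i_1<i_1+a+\ell_n\le j_1<j_1+b\le n$. Condition $D_T^{(s)}(u_n)$ ($s\ge1$) for $\{Y_n\}$ (which is a $T$-periodic sequence): $\{Y_n\}$ satisfies $D(u_n)$ and there is a sequence of integers $k_n\to+\infty$ with $k_n\ell_n/n\to0$, $k_n\alpha_{n,\ell_n}\to0$ and $$\lim_{n\to+\infty}\frac nT\sum_{i=1}^{T}P\Big(Y_i>u_n\ge M^{(\mathbf Y)}_{i+1,i+s-1},\ M^{(\mathbf Y)}_{i+s,[\frac{n}{k_nT}]T}>u_n\Big)=0.$$ *)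

theory Defs
  imports "HOL-Probability.Probability" "HOL-Library.Landau_Symbols"
begin

text \<open>
  The maximum is taken in the extended reals, so that it equals minus infinity
  when \<open>i > j\<close>.
\<close>
definition seq_max :: "(nat \<Rightarrow> 'a \<Rightarrow> real) \<Rightarrow> nat \<Rightarrow> nat \<Rightarrow> 'a \<Rightarrow> ereal" where
  "seq_max W i j \<omega> = (SUP m\<in>{i..j}. ereal (W m \<omega>))"

text \<open>
  The mixing coefficient \<open>\<alpha>\<^bsub>n,l\<^esub>\<close> at level \<open>v\<close>.  Inserting 0 only
  fixes the value 0 for the supremum when no index tuple is admissible.  It also absorbs
  the tuples with \<open>a < 0\<close>, for which the first maximum is minus infinity and the
  difference vanishes, so it suffices to let \<open>a\<close> be a natural number.
\<close>
definition mixing_coeff ::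
    "'a measure \<Rightarrow> (nat \<Rightarrow> 'a \<Rightarrow> real) \<Rightarrow> real \<Rightarrow> nat \<Rightarrow> nat \<Rightarrow> real" where
  "mixing_coeff M W v n l = Sup (insert 0
     {\<bar>\<P>(\<omega> in M. seq_max W i (i + a) \<omega> \<le> ereal v \<and> seq_max W j (j + b) \<omega> \<le> ereal v)
        - \<P>(\<omega> in M. seq_max W i (i + a) \<omega> \<le> ereal v)
          * \<P>(\<omega> in M. seq_max W j (j + b) \<omega> \<le> ereal v)\<bar>
      | i a j b. 1 \<le> i \<and> i < i + a + l \<and> i + a + l \<le> j \<and> j < j + b \<and> j + b \<le> n})"

text \<open>
  Condition \<open>D(u\<^sub>n)\<close> with named sequence \<open>l\<close>; the condition itself is
  \<open>\<exists>l. cond_D_with M W u l\<close>.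
\<close>
definition cond_D_with ::
    "'a measure \<Rightarrow> (nat \<Rightarrow> 'a \<Rightarrow> real) \<Rightarrow> (nat \<Rightarrow> real) \<Rightarrow> (nat \<Rightarrow> nat) \<Rightarrow> bool" where
  "cond_D_with M W u l \<longleftrightarrow>
     (\<lambda>n. real (l n)) \<in> o(\<lambda>n. real n) \<and>
     (\<lambda>n. mixing_coeff M W (u n) n (l n)) \<longlonglongrightarrow> 0"

text \<open>
  The condition \<open>D\<^sub>T\<^bsup>(s)\<^esup>(u\<^sub>n)\<close>; the sequence \<open>l\<close> occurring in the
  requirements on \<open>k\<close> is the one witnessing \<open>D(u\<^sub>n)\<close>, whence the joint
  existential quantifier.  It is meant for \<open>T\<close>-periodic \<open>W\<close>, but periodicity is
  not part of the condition.
\<close>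
definition cond_DT ::
    "'a measure \<Rightarrow> nat \<Rightarrow> nat \<Rightarrow> (nat \<Rightarrow> 'a \<Rightarrow> real) \<Rightarrow> (nat \<Rightarrow> real) \<Rightarrow> bool" where
  "cond_DT M T s W u \<longleftrightarrow> (\<exists>l k :: nat \<Rightarrow> nat.
     cond_D_with M W u l \<and>
     filterlim k at_top sequentially \<and>
     (\<lambda>n. real (k n) * real (l n) / real n) \<longlonglongrightarrow> 0 \<and>
     (\<lambda>n. real (k n) * mixing_coeff M W (u n) n (l n)) \<longlonglongrightarrow> 0 \<and>
     (\<lambda>n. real n / real T * (\<Sum>i=1..T. \<P>(\<omega> in M.
         W i \<omega> > u n \<and> ereal (u n) \<ge> seq_max W (i + 1) (i + s - 1) \<omega> \<and>
         seq_max W (i + s) (n div (k n * T) * T) \<omega> > ereal (u n)))) \<longlonglongrightarrow> 0)"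

text \<open>Invariance of all finite-dimensional distributions under time shifts.\<close>
definition strictly_stationary :: "'a measure \<Rightarrow> (nat \<Rightarrow> 'a \<Rightarrow> real) \<Rightarrow> bool" where
  "strictly_stationary M X \<longleftrightarrow> (\<forall>I h. finite I \<longrightarrow>
     distr M (\<Pi>\<^sub>M i\<in>I. borel) (\<lambda>\<omega>. \<lambda>i\<in>I. X (i + h) \<omega>)
       = distr M (\<Pi>\<^sub>M i\<in>I. borel) (\<lambda>\<omega>. \<lambda>i\<in>I. X i \<omega>))"

end

theory Submission
  imports Defs
begin

text \<open>
  Suppose \<open>Y\<^sub>i > v \<ge> Y\<^bsub>i+1\<^esub>\<close> with \<open>1 \<le> i \<le> T\<close>.  Some \<open>U\<^sub>j X\<^sub>j\<close> of the
  current period exceeds \<open>v\<close>, so \<open>U\<^bsub>i+1\<^esub> = 0\<close> would force \<open>Y\<^bsub>i+1\<^esub> > v\<close>.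
  Hence \<open>U\<^bsub>i+1\<^esub> = 1\<close> and \<open>X\<^bsub>i+1\<^esub> = Y\<^bsub>i+1\<^esub> \<le> v\<close>.  A later exceedance of \<open>v\<close>
  by some \<open>Y\<^sub>m\<close> with \<open>m > i + T\<close> comes from an exceedance by some \<open>X\<^sub>j\<close> with \<open>j \<ge> i + 2\<close>.
  Shifting by \<open>T - i\<close>, stationarity bounds the probability of each of the \<open>T\<close> summands
  by that in the hypothesis on \<open>X\<close>.
\<close>

text \<open>On an empty range both sides are false, since the supremum in \<open>ereal\<close> is
  then minus infinity.\<close>

lemma ereal_less_seq_max_iff: "ereal v < seq_max W i j \<omega> \<longleftrightarrow> (\<exists>m\<in>{i..j}. v < W m \<omega>)"
  by (simp add: seq_max_def less_SUP_iff)

lemma seq_max_le_ereal_iff: "seq_max W i j \<omega> \<le> ereal v \<longleftrightarrow> (\<forall>m\<in>{i..j}. W m \<omega> \<le> v)"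
  by (simp add: seq_max_def SUP_le_iff)

lemma strictly_stationary_measure_shift:
  assumes X: "\<And>n. X n \<in> borel_measurable M"
    and stat: "strictly_stationary M X"
    and I: "finite I"
    and A: "A \<in> sets (\<Pi>\<^sub>M i\<in>I. borel)"
  shows "\<P>(\<omega> in M. (\<lambda>i\<in>I. X (i + h) \<omega>) \<in> A) = \<P>(\<omega> in M. (\<lambda>i\<in>I. X i \<omega>) \<in> A)"
proof -
  have *: "measure (distr M (\<Pi>\<^sub>M i\<in>I. borel) (\<lambda>\<omega>. \<lambda>i\<in>I. X (i + g) \<omega>)) A
      = \<P>(\<omega> in M. (\<lambda>i\<in>I. X (i + g) \<omega>) \<in> A)" for g
  proof -
    have "(\<lambda>\<omega>. \<lambda>i\<in>I. X (i + g) \<omega>) \<in> measurable M (\<Pi>\<^sub>M i\<in>I. borel)"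
      by (intro measurable_restrict X)
    from measure_distr[OF this A] show ?thesis
      by (simp add: vimage_def Int_def conj_commute)
  qed
  show ?thesis
    using stat I *[of h] *[of 0] unfolding strictly_stationary_def by simp
qed

text \<open>Lying almost surely in \<open>{0, 1}\<close> is a property of the law alone, and
  \<open>of_bool\<close> takes no other values.\<close>

lemma AE_in_01_of_bernoulli_distr:
  fixes V :: "'a \<Rightarrow> real"
  assumes V: "V \<in> borel_measurable M"
    and distr: "distr M borel V = distr (measure_pmf q) borel of_bool"
  shows "AE \<omega> in M. V \<omega> \<in> {0, 1}"
proof -
  have "AE x in distr (measure_pmf q) borel (of_bool :: bool \<Rightarrow> real). x \<in> {0, 1}"
    by (subst AE_distr_iff) (auto simp: AE_measure_pmf_iff)
  then show ?thesis
    unfolding distr[symmetric] using V by (subst (asm) AE_distr_iff) auto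
qed

text \<open>As \<open>U n\<close> is 0 or 1, \<open>Y n\<close> is either \<open>X n\<close> or the
  maximum over the window \<open>{(n - 1) div T * T..n - 1}\<close>. In that maximum an index with
  \<open>U j = 0\<close> contributes 0, which cannot exceed the positive level
  \<open>v\<close>.\<close>

lemma exceedance_of_recent_max:
  fixes U X Y :: "nat \<Rightarrow> real"
  assumes v: "0 < v"
    and U01: "\<And>j. U j \<in> {0, 1}"
    and Y: "Y n = U n * X n + (1 - U n) * (MAX i\<in>{(n - 1) div T * T..n - 1}. U i * X i)"
    and gt: "v < Y n"
  obtains j where "(n - 1) div T * T \<le> j" "j \<le> n" "U j = 1" "v < X j"
proof (cases "U n = 1")
  case True
  have "(n - 1) div T * T \<le> n"
    by (metis diff_le_self div_times_less_eq_dividend le_trans)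
  with True that[of n] gt Y show ?thesis by simp
next
  case False
  let ?A = "{(n - 1) div T * T..n - 1}"
  have "v < (MAX i\<in>?A. U i * X i)"
    using False U01[of n] gt Y by simp
  then obtain j where j: "j \<in> ?A" "v < U j * X j"
    by (subst (asm) Max_gr_iff) auto
  with v U01[of j] have "U j = 1" "v < X j" by auto
  with j that[of j] show ?thesis by auto
qed

text \<open>The pathwise part of the argument, for one path outside the exceptional null set. The
  last range ends at \<open>r + i\<close> rather than at \<open>r\<close>, so that a shift by
  \<open>T - i\<close> carries it exactly to the range ending at \<open>r + T\<close>.\<close>

lemma exceedance_transfer:
  fixes U X Y :: "nat \<Rightarrow> real"
  assumes T: "T \<ge> 2" and v: "0 < v"
    and U01: "\<And>j. U j \<in> {0, 1}"
    and U_one: "\<And>m. U (m * T) = 1"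
    and Y: "\<And>n. n \<ge> 1 \<Longrightarrow>
          Y n = U n * X n + (1 - U n) * (MAX i\<in>{(n - 1) div T * T..n - 1}. U i * X i)"
    and i: "1 \<le> i" "i \<le> T"
    and gt: "v < Y i" and le: "Y (Suc i) \<le> v"
    and m: "i + T < m" "m \<le> r" "v < Y m"
  shows "\<exists>j\<in>{0..i}. v < X j" "X (i + 1) \<le> v" "\<exists>j\<in>{i + 2..r + i}. v < X j"
proof -
  obtain j where j: "j \<le> i" "U j = 1" "v < X j"
    by (rule exceedance_of_recent_max[where U = U and X = X and Y = Y, OF v U01 Y[OF i(1)] gt])
  then show "\<exists>j\<in>{0..i}. v < X j" by auto
  have "U (Suc i) = 1"
  proof (rule ccontr)
    assume "U (Suc i) \<noteq> 1"
    with U01[of "Suc i"] have "Y (Suc i) = (MAX j\<in>{i div T * T..i}. U j * X j)"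
      by (auto simp: Y)
    moreover have "v < (MAX j\<in>{i div T * T..i}. U j * X j)"
    \<comment> \<open>For \<open>i < T\<close> the window of \<open>Y (Suc i)\<close> starts at 0
      and contains \<open>j\<close>. For \<open>i = T\<close> it consists of \<open>T\<close> alone
      and may miss \<open>j\<close>, but \<open>U T = 1\<close> turns the exceedance by
      \<open>Y T\<close> into one by \<open>X T\<close>.\<close>
    proof (cases "i = T")
      case True
      have "U T = 1" using U_one[of 1] by simp
      then have "v < X T" using gt i Y[of i] True by simp
      with \<open>U T = 1\<close> True T show ?thesis
        by (subst Max_gr_iff) auto
    next
      case False
      with i have "i div T = 0" by simp
      with j show ?thesis
        by (subst Max_gr_iff) (auto intro!: bexI[of _ j])
    qed
    ultimately show False using le by simp
  qed
  then show Xi: "X (i + 1) \<le> v" using le Y[of "Suc i"] by simp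
  have m1: "m \<ge> 1" using m by simp
  obtain j' where j': "(m - 1) div T * T \<le> j'" "j' \<le> m" "v < X j'"
    by (rule exceedance_of_recent_max[where U = U and X = X and Y = Y, OF v U01 Y[OF m1] m(3)])
  have "j' \<ge> i + 2"
  \<comment> \<open>For \<open>i = T\<close> the window of \<open>Y m\<close> starts at
    \<open>2 * T\<close> or later, and \<open>2 * T \<ge> T + 2\<close>. For \<open>i < T\<close> it
    starts at \<open>T \<ge> i + 1\<close> or later, and \<open>j' = i + 1\<close> is excluded by
    \<open>X (i + 1) \<le> v\<close>.\<close>
  proof (cases "i = T")
    case True
    have "2 = (2 * T) div T" using T by simp
    also have "\<dots> \<le> (m - 1) div T" using m True by (intro div_le_mono) simp
    finally have "2 * T \<le> j'" using j'(1) by (meson le_trans mult_le_mono1)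
    with True T show ?thesis by simp
  next
    case False
    have "1 = T div T" using T by simp
    also have "\<dots> \<le> (m - 1) div T" using m i by (intro div_le_mono) simp
    finally have "1 * T \<le> j'" using j'(1) by (meson le_trans mult_le_mono1)
    moreover have "j' \<noteq> i + 1" using Xi j'(3) by auto
    ultimately show ?thesis using False i by simp
  qed
  with j' m show "\<exists>j\<in>{i + 2..r + i}. v < X j" by (intro bexI[of _ j']) auto
qed

text \<open>The shift by \<open>T - i\<close> takes the second and third conditions on the left
  exactly to those on the right. The inequality comes only from the first range, which becomes
  \<open>{T - i..T}\<close> and is enlarged to \<open>{0..T}\<close>.\<close>

lemma strictly_stationary_exceedance_le:
  fixes X :: "nat \<Rightarrow> 'a \<Rightarrow> real"
  assumes "prob_space M" and X: "\<And>n. X n \<in> borel_measurable M"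
    and stat: "strictly_stationary M X"
    and i: "i \<le> T"
  shows "\<P>(\<omega> in M. (\<exists>j\<in>{0..i}. v < X j \<omega>) \<and> X (i + 1) \<omega> \<le> v \<and> (\<exists>j\<in>{i + 2..r + i}. v < X j \<omega>))
     \<le> \<P>(\<omega> in M. (\<exists>j\<in>{0..T}. v < X j \<omega>) \<and> X (T + 1) \<omega> \<le> v \<and> (\<exists>j\<in>{T + 2..r + T}. v < X j \<omega>))"
proof -
  interpret prob_space M by fact
  note X[measurable]
  \<comment> \<open>A finite index set containing all times in the event; the summand 1 keeps
    \<open>i + 1\<close> inside also when \<open>r = 0\<close>.\<close>
  define I where "I = {0..r + i + 1}"
  define A where "A = {x \<in> space (\<Pi>\<^sub>M i\<in>I. (borel :: real measure)).
      (\<exists>j\<in>{0..i}. v < x j) \<and> x (i + 1) \<le> v \<and> (\<exists>j\<in>{i + 2..r + i}. v < x j)}"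
  have A: "A \<in> sets (\<Pi>\<^sub>M i\<in>I. borel)"
  proof -
    have [measurable]: "(\<lambda>x. x j) \<in> borel_measurable (\<Pi>\<^sub>M i\<in>I. (borel :: real measure))"
      if "j \<le> r + i + 1" for j
      using that by (intro measurable_component_singleton) (simp add: I_def)
    show ?thesis unfolding A_def
      by (intro sets.sets_Collect_conj sets.sets_Collect_finite_Ex) auto
  qed
  have space: "(\<lambda>i\<in>I. X (i + h) \<omega>) \<in> space (\<Pi>\<^sub>M i\<in>I. (borel :: real measure))" for h \<omega>
    by (simp add: space_PiM)
  have mem: "(\<lambda>i\<in>I. X (i + h) \<omega>) \<in> A \<longleftrightarrow> (\<exists>j\<in>{0..i}. v < X (j + h) \<omega>) \<and> X (i + 1 + h) \<omega> \<le> v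
      \<and> (\<exists>j\<in>{i + 2..r + i}. v < X (j + h) \<omega>)" for h \<omega>
    using space[of h \<omega>] unfolding A_def by (auto simp: I_def)
  have "\<P>(\<omega> in M. (\<exists>j\<in>{0..i}. v < X j \<omega>) \<and> X (i + 1) \<omega> \<le> v \<and> (\<exists>j\<in>{i + 2..r + i}. v < X j \<omega>))
      = \<P>(\<omega> in M. (\<lambda>j\<in>I. X (j + 0) \<omega>) \<in> A)"
    unfolding mem by simp
  also have "\<dots> = \<P>(\<omega> in M. (\<lambda>j\<in>I. X (j + (T - i)) \<omega>) \<in> A)"
    using strictly_stationary_measure_shift[OF X stat _ A, of "T - i"] by (simp add: I_def)
  also have "\<dots> \<le> \<P>(\<omega> in M. (\<exists>j\<in>{0..T}. v < X j \<omega>) \<and> X (T + 1) \<omega> \<le> v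
      \<and> (\<exists>j\<in>{T + 2..r + T}. v < X j \<omega>))"
  proof (rule finite_measure_mono)
    have "\<exists>j\<in>{a + (T - i)..b + (T - i)}. v < X j \<omega>" if "\<exists>j\<in>{a..b}. v < X (j + (T - i)) \<omega>" for a b \<omega>
      using that by (auto intro!: bexI[of _ "_ + (T - i)"])
    from this[of 0 i] this[of "i + 2" "r + i"] i
    show "{\<omega> \<in> space M. (\<lambda>j\<in>I. X (j + (T - i)) \<omega>) \<in> A} \<subseteq>
      {\<omega> \<in> space M. (\<exists>j\<in>{0..T}. v < X j \<omega>) \<and> X (T + 1) \<omega> \<le> v \<and> (\<exists>j\<in>{T + 2..r + T}. v < X j \<omega>)}"
      unfolding mem by fastforce
  qed measurable
  finally show ?thesis .
qed

theorem theorem3p2: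
  fixes M :: "'a measure" and T :: nat and p :: real
    and U X Y :: "nat \<Rightarrow> 'a \<Rightarrow> real" and F :: "real \<Rightarrow> real"
    and u :: "nat \<Rightarrow> real" and l k :: "nat \<Rightarrow> nat"
  assumes M: "prob_space M"
    and T: "T \<ge> 2"
    and p: "0 < p" "p < 1"
    and U_indep: "prob_space.indep_vars M (\<lambda>_. borel) U UNIV"
    and U_one: "\<And>m. AE \<omega> in M. U (m * T) \<omega> = 1"
    and U_bernoulli: "\<And>n. \<not> T dvd n \<Longrightarrow>
          distr M borel (U n) = distr (measure_pmf (bernoulli_pmf p)) borel of_bool"
    and X_rv: "\<And>n. X n \<in> borel_measurable M"
    and X_pos: "\<And>n. AE \<omega> in M. X n \<omega> > 0"
    and X_stationary: "strictly_stationary M X"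
    and X_cdf: "\<And>n. cdf (distr M borel (X n)) = F"
    and F_cont: "continuous_on UNIV F"
    and XU_indep: "prob_space.indep_var M
          (\<Pi>\<^sub>M n\<in>UNIV. borel) (\<lambda>\<omega> n. X n \<omega>)
          (\<Pi>\<^sub>M n\<in>UNIV. borel) (\<lambda>\<omega> n. U n \<omega>)"
    and Y: "\<And>n \<omega>. n \<ge> 1 \<Longrightarrow> \<omega> \<in> space M \<Longrightarrow>
          Y n \<omega> = U n \<omega> * X n \<omega>
            + (1 - U n \<omega>) * (MAX i\<in>{(n - 1) div T * T..n - 1}. U i \<omega> * X i \<omega>)"
    and u_pos: "\<And>n. n \<ge> 1 \<Longrightarrow> u n > 0"
    and Y_D: "cond_D_with M Y u l"
    and k_pos: "\<And>n. n \<ge> 1 \<Longrightarrow> k n > 0"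
    and k_lim: "filterlim k at_top sequentially"
    and kl: "(\<lambda>n. real (k n) * real (l n) / real n) \<longlonglongrightarrow> 0"
    and k_alpha: "(\<lambda>n. real (k n) * mixing_coeff M Y (u n) n (l n)) \<longlonglongrightarrow> 0"
    and X_cond: "(\<lambda>n. real n * \<P>(\<omega> in M.
          seq_max X 0 T \<omega> > ereal (u n) \<and> u n \<ge> X (T + 1) \<omega> \<and>
          seq_max X (T + 2) (n div (k n * T) * T + T) \<omega> > ereal (u n))) \<longlonglongrightarrow> 0"
  shows "cond_DT M T (T + 1) Y u"
proof -
  interpret prob_space M by (rule M)
  note X_rv[measurable]
  \<comment> \<open>The quantifier over \<open>j\<close> stands inside the almost sure statement:
    the pathwise argument needs one null set for all indices.\<close>
  have U01: "AE \<omega> in M. \<forall>j. U j \<omega> \<in> {0, 1}"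
  proof (subst AE_all_countable, rule allI)
    fix j
    show "AE \<omega> in M. U j \<omega> \<in> {0, 1}"
    proof (cases "T dvd j")
      case True
      then obtain m where "j = m * T" by (metis dvdE mult.commute)
      then show ?thesis using U_one[of m] by (auto elim: AE_mp)
    next
      case False
      have "random_variable borel (U j)"
        using U_indep by (simp add: indep_vars_def)
      then show ?thesis by (rule AE_in_01_of_bernoulli_distr[OF _ U_bernoulli[OF False]])
    qed
  qed
  have U1: "AE \<omega> in M. \<forall>m. U (m * T) \<omega> = 1"
    using U_one by (simp add: AE_all_countable)
  define r where "r n = n div (k n * T) * T" for n
  define B where "B n = \<P>(\<omega> in M. (\<exists>j\<in>{0..T}. u n < X j \<omega>) \<and> X (T + 1) \<omega> \<le> u n
      \<and> (\<exists>j\<in>{T + 2..r n + T}. u n < X j \<omega>))" for n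
  define E where "E n i = {\<omega> \<in> space M. Y i \<omega> > u n \<and> ereal (u n) \<ge> seq_max Y (i + 1) (i + (T + 1) - 1) \<omega> \<and>
         seq_max Y (i + (T + 1)) (n div (k n * T) * T) \<omega> > ereal (u n)}" for n i
  have B_lim: "(\<lambda>n. real n * B n) \<longlonglongrightarrow> 0"
    using X_cond unfolding B_def r_def ereal_less_seq_max_iff by simp
  have summand_le: "prob (E n i) \<le> B n"
    if n: "n \<ge> 1" and i: "i \<in> {1..T}" for n i
  proof -
    have "prob (E n i)
      \<le> \<P>(\<omega> in M. (\<exists>j\<in>{0..i}. u n < X j \<omega>) \<and> X (i + 1) \<omega> \<le> u n
          \<and> (\<exists>j\<in>{i + 2..r n + i}. u n < X j \<omega>))"
    proof (rule finite_measure_mono_AE)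
      show "AE \<omega> in M. \<omega> \<in> E n i \<longrightarrow>
         \<omega> \<in> {\<omega> \<in> space M. (\<exists>j\<in>{0..i}. u n < X j \<omega>) \<and> X (i + 1) \<omega> \<le> u n
          \<and> (\<exists>j\<in>{i + 2..r n + i}. u n < X j \<omega>)}"
        using U01 U1 AE_space
      proof eventually_elim
        case (elim \<omega>)
        show ?case
        proof (intro impI)
          assume "\<omega> \<in> E n i"
          \<comment> \<open>Of the \<open>T\<close> non-exceedances after time \<open>i\<close> only
            the first, at \<open>Suc i\<close>, is kept.\<close>
          then obtain m where *: "u n < Y i \<omega>" "Y (Suc i) \<omega> \<le> u n"
              "i + T < m" "m \<le> r n" "u n < Y m \<omega>"
            using T unfolding E_def ereal_less_seq_max_iff seq_max_le_ereal_iff r_def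
            by (auto simp: Suc_le_eq)
          note transfer = exceedance_transfer[where U = "\<lambda>j. U j \<omega>" and X = "\<lambda>j. X j \<omega>"
              and Y = "\<lambda>j. Y j \<omega>", OF T u_pos[OF n] _ _ Y[OF _ elim(3)] _ _ *]
          show "\<omega> \<in> {\<omega> \<in> space M. (\<exists>j\<in>{0..i}. u n < X j \<omega>) \<and> X (i + 1) \<omega> \<le> u n
              \<and> (\<exists>j\<in>{i + 2..r n + i}. u n < X j \<omega>)}"
            using transfer elim i by simp
        qed
      qed
    qed measurable
    also have "\<dots> \<le> B n"
      unfolding B_def using i by (intro strictly_stationary_exceedance_le M X_rv X_stationary) simp
    finally show ?thesis .
  qed
  have "(\<lambda>n. real n / real T * (\<Sum>i=1..T. prob (E n i))) \<longlonglongrightarrow> 0"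
  \<comment> \<open>Each of the \<open>T\<close> summands is at most \<open>B n\<close>, so the
    factor \<open>1 / T\<close> cancels their number. The bound starts at \<open>n = 1\<close>,
    where \<open>u n\<close> is known to be positive.\<close>
  proof (rule tendsto_sandwich[OF _ _ tendsto_const B_lim])
    show "\<forall>\<^sub>F n in sequentially. 0 \<le> real n / real T * (\<Sum>i=1..T. prob (E n i))"
      by (intro always_eventually allI mult_nonneg_nonneg) (auto intro: sum_nonneg)
    have "real n / real T * (\<Sum>i=1..T. prob (E n i)) \<le> real n * B n" if "n \<ge> 1" for n
    proof -
      have "(\<Sum>i=1..T. prob (E n i)) \<le> real T * B n"
        using sum_bounded_above[of "{1..T}" "\<lambda>i. prob (E n i)" "B n"] summand_le[OF that] by simp
      then have "real n / real T * (\<Sum>i=1..T. prob (E n i)) \<le> real n / real T * (real T * B n)"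
        by (intro mult_left_mono) auto
      with T show ?thesis by simp
    qed
    then show "\<forall>\<^sub>F n in sequentially. real n / real T * (\<Sum>i=1..T. prob (E n i)) \<le> real n * B n"
      using eventually_sequentially by blast
  qed
  then show ?thesis
    unfolding cond_DT_def E_def using Y_D k_lim kl k_alpha by blast
qed

end
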